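(* For every integer $n\ge 1$, the matrix ring over dual numbers $M_n(\mathbb{D})$ is not nil-clean.
   Context: $\mathbb{D}=\{a+b\epsilon \mid a,b\in\mathbb{R},\ \epsilon^2=0\}$ is the ring of dual numbers, and $M_n(\mathbb{D})$ is the ring of $n\times n$ matrices over $\mathbb{D}$. An element $a$ of a ring $R$ (associative with identity) is nil-clean if $a=e+t$ where $e\in R$ is idempotent and $t\in R$ is nilpotent. A ring is nil-clean if every element of it is nil-clean. *)

theory Defs
  imports Complex_Main "Jordan_Normal_Form.Matrix"
begin

section \<open>Dual numbers\<close>

text \<open>\<open>Dual a b\<close> stands for $a + b\epsilon$ with $\epsilon^2 = 0$;
  see \<open>dual_eps_squared\<close> and \<open>Dual_eq\<close> below.\<close>

datatype dual = Dual (std_part: real) (eps_part: real)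

instantiation dual :: comm_ring_1
begin

definition zero_dual :: dual where "0 = Dual 0 0"

definition one_dual :: dual where "1 = Dual 1 0"

definition plus_dual :: "dual \<Rightarrow> dual \<Rightarrow> dual" where
  "x + y = Dual (std_part x + std_part y) (eps_part x + eps_part y)"

definition uminus_dual :: "dual \<Rightarrow> dual" where
  "- x = Dual (- std_part x) (- eps_part x)"

definition minus_dual :: "dual \<Rightarrow> dual \<Rightarrow> dual" where
  "x - y = Dual (std_part x - std_part y) (eps_part x - eps_part y)"

definition times_dual :: "dual \<Rightarrow> dual \<Rightarrow> dual" where
  "x * y = Dual (std_part x * std_part y)
                (std_part x * eps_part y + eps_part x * std_part y)"

instance
  by standard
    (simp_all add: zero_dual_def one_dual_def plus_dual_def uminus_dual_def
      minus_dual_def times_dual_def algebra_simps)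

end

instantiation dual :: real_algebra_1
begin

definition scaleR_dual :: "real \<Rightarrow> dual \<Rightarrow> dual" where
  "r *\<^sub>R x = Dual (r * std_part x) (r * eps_part x)"

instance
  by standard
    (simp_all add: scaleR_dual_def plus_dual_def times_dual_def algebra_simps)

end

definition dual_eps :: dual where
  "dual_eps = Dual 0 1"

lemma dual_eps_squared: "dual_eps ^ 2 = 0"
  by (simp add: dual_eps_def power2_eq_square times_dual_def zero_dual_def)

lemma Dual_eq: "Dual a b = of_real a + of_real b * dual_eps"
  by (simp add: dual_eps_def of_real_def scaleR_dual_def one_dual_def
      plus_dual_def times_dual_def)


section \<open>Nil-clean rings\<close>

definition idempotent_elem :: "('a, 'b) ring_scheme \<Rightarrow> 'a \<Rightarrow> bool" where
  "idempotent_elem R e \<longleftrightarrow> e \<in> carrier R \<and> e \<otimes>\<^bsub>R\<^esub> e = e"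

definition nilpotent_elem :: "('a, 'b) ring_scheme \<Rightarrow> 'a \<Rightarrow> bool" where
  "nilpotent_elem R t \<longleftrightarrow>
     t \<in> carrier R \<and> (\<exists>k::nat. k \<ge> 1 \<and> t [^]\<^bsub>R\<^esub> k = \<zero>\<^bsub>R\<^esub>)"

definition nil_clean_elem :: "('a, 'b) ring_scheme \<Rightarrow> 'a \<Rightarrow> bool" where
  "nil_clean_elem R a \<longleftrightarrow>
     (\<exists>e t. idempotent_elem R e \<and> nilpotent_elem R t \<and> a = e \<oplus>\<^bsub>R\<^esub> t)"

text \<open>These notions are meant for \<open>R\<close> with \<open>ring R\<close>. That is deliberately not a conjunct of
  the following definition, so that its negation cannot hold merely because \<open>R\<close> fails to be
  a ring.\<close>

definition nil_clean_ring :: "('a, 'b) ring_scheme \<Rightarrow> bool" where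
  "nil_clean_ring R \<longleftrightarrow> (\<forall>a\<in>carrier R. nil_clean_elem R a)"


section \<open>Matrices over the dual numbers\<close>

abbreviation dual_mat_ring :: "nat \<Rightarrow> dual mat ring" where
  "dual_mat_ring n \<equiv> ring_mat TYPE(dual) n ()"

lemma ring_dual_mat_ring: "ring (dual_mat_ring n)"
  by (rule ring_mat)

end

(* If 1 + 1 = e + t with e idempotent and t nilpotent, then e t = e (1 + 1) - e = e, hence
   e = e t^k = 0 for large k and 1 + 1 = t is nilpotent. Over the dual numbers, whose
   characteristic is 0, the matrix 1 + 1 is not nilpotent. *)

theory Submission
  imports Defs
begin

lemma (in ring) nilpotent_two_if_nil_clean:
  assumes "nil_clean_elem R (\<one> \<oplus> \<one>)"
  shows "nilpotent_elem R (\<one> \<oplus> \<one>)"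
proof -
  obtain e t where e: "e \<in> carrier R" "e \<otimes> e = e"
    and nil: "nilpotent_elem R t" and et: "\<one> \<oplus> \<one> = e \<oplus> t"
    using assms unfolding nil_clean_elem_def idempotent_elem_def by blast
  then obtain k :: nat where t: "t \<in> carrier R" "t [^] k = \<zero>"
    unfolding nilpotent_elem_def by blast
  have "e \<oplus> e = e \<otimes> (\<one> \<oplus> \<one>)"
    using e by (simp add: r_distr)
  also have "\<dots> = e \<oplus> e \<otimes> t"
    using e t by (simp add: et r_distr)
  finally have step: "e \<otimes> t = e"
    using e t by simp
  \<comment> \<open>Reassociating \<open>e \<otimes> (t [^] j \<otimes> t)\<close> lets
    \<open>e\<close> absorb the factors \<open>t\<close> one at a time; \<open>j = k\<close> then
    gives \<open>e = \<zero>\<close>.\<close>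
  have "e \<otimes> t [^] j = e" for j :: nat
    using e t step by (induction j) (simp_all flip: m_assoc)
  then have "e = \<zero>"
    using e t by (metis r_null)
  then show ?thesis
    using nil et t by simp
qed

text \<open>Powers of a scalar matrix are scalar, which reduces nilpotency of
  \<open>\<one> \<oplus> \<one>\<close> to a question about the dual number 2.\<close>

lemma dual_mat_two_pow:
  fixes k :: nat
  shows "(\<one>\<^bsub>dual_mat_ring n\<^esub> \<oplus>\<^bsub>dual_mat_ring n\<^esub> \<one>\<^bsub>dual_mat_ring n\<^esub>) [^]\<^bsub>dual_mat_ring n\<^esub> k
    = 2 ^ k \<cdot>\<^sub>m 1\<^sub>m n"
proof -
  have "1\<^sub>m n + 1\<^sub>m n = (2 :: dual) \<cdot>\<^sub>m 1\<^sub>m n"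
    by (rule eq_matI) auto
  then show ?thesis
    by (induction k) (auto simp: ring_mat_simps nat_pow_def intro!: eq_matI)
qed

theorem proposition4p4:
  fixes n :: nat
  assumes "n \<ge> 1"
  shows "\<not> nil_clean_ring (dual_mat_ring n)"
proof
  let ?R = "dual_mat_ring n"
  interpret ring ?R by (rule ring_dual_mat_ring)
  assume "nil_clean_ring ?R"
  then have "nilpotent_elem ?R (\<one>\<^bsub>?R\<^esub> \<oplus>\<^bsub>?R\<^esub> \<one>\<^bsub>?R\<^esub>)"
    by (intro nilpotent_two_if_nil_clean) (simp add: nil_clean_ring_def)
  then obtain k :: nat where "2 ^ k \<cdot>\<^sub>m 1\<^sub>m n = (0\<^sub>m n n :: dual mat)"
    unfolding nilpotent_elem_def dual_mat_two_pow by (auto simp: ring_mat_simps)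
  \<comment> \<open>This entry exists because \<open>n \<ge> 1\<close>; for \<open>n = 0\<close> the
    ring is zero and hence nil-clean.\<close>
  then have "(2 ^ k \<cdot>\<^sub>m 1\<^sub>m n) $$ (0, 0) = (0\<^sub>m n n :: dual mat) $$ (0, 0)"
    by simp
  then have "(2 :: dual) ^ k = 0"
    using assms by simp
  \<comment> \<open>\<open>dual\<close> has zero divisors, so the power is moved to
    \<open>nat\<close>; \<open>of_nat\<close> is injective in characteristic 0.\<close>
  moreover have "(2 :: dual) ^ k = of_nat (2 ^ k)"
    by simp
  ultimately show False
    by (metis of_nat_eq_0_iff power_not_zero zero_neq_numeral)
qed

end
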